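(* Let $b_n\ge0$ ($n\ge1$) be integers and, for $p\in[0,1]$, let $\widehat T^p_{b_1,b_2,\dots}=\inf\{n\ge1:|U_n^p|\ge b_n\}$. Then $\widehat T^p_{b_1,b_2,\dots}$ is stochastically maximized over $p\in[0,1]$ by $p=\frac12$.
   Context: For $p\in[0,1]$, let $X_1^p,X_2^p,\dots$ be i.i.d. with $P(X_n^p=1)=p$ and $P(X_n^p=-1)=1-p$, and let $X_0\in\{+1,-1\}$ be independent of $X_1^p,X_2^p,\dots$ with $P(X_0=1)=P(X_0=-1)=\frac12$. Set $U_0^p=X_0$ and $U_n^p=X_0+X_1^p+\cdots+X_n^p$ for $n\ge1$. Convention: $\inf\emptyset=\infty$. A family of $\{1,2,\dots\}\cup\{\infty\}$-valued random variables $T^p$ is stochastically maximized over $p\in[0,1]$ by $p=\frac12$ if $P(T^p>n)\le P(T^{1/2}>n)$ for every $n\ge1$ and every $p\in[0,1]$ (the usual stochastic order). *)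

theory Defs
  imports "HOL-Probability.Probability" "HOL-Library.Extended_Nat"
begin

text \<open>
  Only the values \<open>X n\<close> with \<open>n \<ge> 1\<close> are used. Independence of the whole family
  \<open>X0, X 1, X 2, \<dots>\<close> says both that the steps are mutually independent and that \<open>X0\<close> is
  independent of the sequence of steps; it also contains measurability. The values
  \<open>\<plusminus>1\<close> are attained almost surely.
\<close>

locale random_sign_walk = prob_space M
  for M :: "'a measure" and p :: real and X0 :: "'a \<Rightarrow> int" and X :: "nat \<Rightarrow> 'a \<Rightarrow> int" +
  assumes indep: "indep_vars (\<lambda>_. count_space UNIV) (\<lambda>n. if n = 0 then X0 else X n) UNIV"
    and start_pos: "prob {\<omega> \<in> space M. X0 \<omega> = 1} = 1 / 2"
    and start_neg: "prob {\<omega> \<in> space M. X0 \<omega> = - 1} = 1 / 2"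
    and step_pos: "n \<ge> 1 \<Longrightarrow> prob {\<omega> \<in> space M. X n \<omega> = 1} = p"
    and step_neg: "n \<ge> 1 \<Longrightarrow> prob {\<omega> \<in> space M. X n \<omega> = - 1} = 1 - p"

definition walk :: "('a \<Rightarrow> int) \<Rightarrow> (nat \<Rightarrow> 'a \<Rightarrow> int) \<Rightarrow> nat \<Rightarrow> 'a \<Rightarrow> int" where
  "walk X0 X n \<omega> = X0 \<omega> + (\<Sum>i = 1..n. X i \<omega>)"

text \<open>On \<^typ>\<open>enat\<close> the infimum of the empty set is \<open>\<infinity>\<close>.\<close>

definition exit_time :: "(nat \<Rightarrow> int) \<Rightarrow> (nat \<Rightarrow> 'a \<Rightarrow> int) \<Rightarrow> 'a \<Rightarrow> enat" where
  "exit_time b U \<omega> = Inf {enat n | n. n \<ge> 1 \<and> \<bar>U n \<omega>\<bar> \<ge> b n}"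

text \<open>The random variables \<open>T p\<close> may live on different probability spaces \<open>M p\<close>.\<close>

definition stochastically_maximized ::
    "('i \<Rightarrow> 'a measure) \<Rightarrow> ('i \<Rightarrow> 'a \<Rightarrow> enat) \<Rightarrow> 'i set \<Rightarrow> 'i \<Rightarrow> bool" where
  "stochastically_maximized M T I q \<longleftrightarrow> q \<in> I \<and>
     (\<forall>n\<ge>1. \<forall>p\<in>I. measure (M p) {\<omega> \<in> space (M p). T p \<omega> > enat n}
                    \<le> measure (M q) {\<omega> \<in> space (M q). T q \<omega> > enat n})"

end

theory Submission
  imports Defs
begin

text \<open>
  The idea is to look at \<open>\<bar>U n\<bar>\<close>, which is all that the exit time sees. For \<open>p = 1/2\<close> this is simple
  random walk reflected at \<open>0\<close>. For \<open>p \<ge> 1/2\<close> the sign of \<open>U n\<close>, given the path of \<open>\<bar>U\<bar>\<close>, is never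
  biased against the drift: the two starting signs are equally likely, each outward step multiplies
  the odds of the positive sign by \<open>p / (1 - p)\<close>, each inward step divides them by the same factor,
  and without a visit to \<open>0\<close> the distance is never below its initial value \<open>1\<close>. After a visit to \<open>0\<close>
  the odds start afresh from \<open>1\<close>, now at distance \<open>0\<close>. Hence \<open>\<bar>U\<bar>\<close> moves outwards with conditional
  probability at least \<open>1/2\<close> at every time, and it dominates the reflected symmetric
  walk, which therefore takes at least as long to reach any barrier. The case \<open>p < 1/2\<close> follows by reflection.

  Instead of a coupling, the proof runs backwards in time with the probability \<open>survival\<close> of staying
  strictly inside the barrier. Lemma \<open>survival_fair_antimono\<close> says that for the fair walk this
  probability decreases in the distance from \<open>0\<close> within each parity class, so moving outwards is harmful. Lemma
  \<open>survival_mixture_le\<close> compares a mixture of two walks with drift, started at \<open>i\<close> and \<open>- i\<close>, with the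
  fair walk started at \<open>i\<close>; the theorem is the mixture with equal weights at \<open>1\<close> and \<open>- 1\<close>. Lemma
  \<open>prob_cylinder_stay\<close> identifies the recursively defined \<open>survival\<close> with probabilities of the walk.
\<close>

section \<open>Survival probabilities of walks with drift\<close>

text \<open>
  There are \<open>m\<close> steps left after time \<open>j\<close>. The position \<open>x\<close> at time \<open>j\<close> is not tested itself, in
  accordance with the exit time, which starts to look at time \<open>1\<close>.
\<close>

fun survival :: "(nat \<Rightarrow> int) \<Rightarrow> real \<Rightarrow> nat \<Rightarrow> nat \<Rightarrow> int \<Rightarrow> real" where
  "survival b p 0 j x = 1"
| "survival b p (Suc m) j x =
     p * (of_bool (\<bar>x + 1\<bar> < b (Suc j)) * survival b p m (Suc j) (x + 1)) +
     (1 - p) * (of_bool (\<bar>x - 1\<bar> < b (Suc j)) * survival b p m (Suc j) (x - 1))"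

lemma survival_nonneg: "0 \<le> p \<Longrightarrow> p \<le> 1 \<Longrightarrow> 0 \<le> survival b p m j x"
  by (induction m arbitrary: j x) auto

lemma survival_reflect: "survival b (1 - p) m j (- x) = survival b p m j x"
proof (induction m arbitrary: j x)
  case (Suc m)
  have "survival b (1 - p) m (Suc j) (1 - x) = survival b p m (Suc j) (x - 1)"
    "survival b (1 - p) m (Suc j) (- x - 1) = survival b p m (Suc j) (x + 1)"
    using Suc[of "Suc j" "x - 1"] Suc[of "Suc j" "x + 1"] by simp_all
  moreover have "\<bar>1 - x\<bar> = \<bar>x - 1\<bar>" "\<bar>- x - 1\<bar> = \<bar>x + 1\<bar>" by auto
  ultimately show ?case by simp
qed simp

lemma survival_fair_abs: "survival b (1 / 2) m j \<bar>x\<bar> = survival b (1 / 2) m j x"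
  using survival_reflect[of b "1 / 2" m j x] by (cases "x \<ge> 0") auto

text \<open>
  Two fair walks at different distances of the same parity can take their next step in such a
  way that the distances keep their order (both outwards or both inwards, after a reflection to
  positions that are not negative), so the inner one is inside the barrier whenever the outer one is.
\<close>

lemma survival_fair_antimono:
  assumes "\<bar>x\<bar> \<le> \<bar>y\<bar>" and "even (y - x)"
  shows "survival b (1 / 2) m j y \<le> survival b (1 / 2) m j x"
  using assms
proof (induction m arbitrary: j x y)
  case (Suc m)
  define x' y' where "x' = \<bar>x\<bar>" and "y' = \<bar>y\<bar>"
  have xy: "0 \<le> x'" "x' \<le> y'" and even: "even (y' - x')"
    using Suc.prems by (auto simp: x'_def y'_def)
  have "survival b (1 / 2) (Suc m) j y' \<le> survival b (1 / 2) (Suc m) j x'"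
  proof (cases "x' = y'")
    case False
    with xy even have gap: "x' + 2 \<le> y'" by presburger
    have up: "\<bar>x' + 1\<bar> \<le> \<bar>y' + 1\<bar>" and down: "\<bar>x' - 1\<bar> \<le> \<bar>y' - 1\<bar>"
      using xy gap by auto
    have "survival b (1 / 2) m (Suc j) (y' + 1) \<le> survival b (1 / 2) m (Suc j) (x' + 1)"
      "survival b (1 / 2) m (Suc j) (y' - 1) \<le> survival b (1 / 2) m (Suc j) (x' - 1)"
      using up down even by (auto intro!: Suc.IH)
    then show ?thesis
      using up down unfolding survival.simps
      by (intro add_mono mult_left_mono mult_mono) (auto intro: survival_nonneg)
  qed simp
  then show ?case
    by (simp only: x'_def y'_def survival_fair_abs)
qed simp

text \<open>
  The weights \<open>\<alpha>\<close> and \<open>\<beta>\<close> are the masses at \<open>i\<close> and at \<open>- i\<close> for one given path of the distance.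
  They are in the ratio \<open>p ^ (i - 1)\<close> to \<open>(1 - p) ^ (i - 1)\<close> as long as \<open>0\<close> has not been visited, and
  \<open>p ^ i\<close> to \<open>(1 - p) ^ i\<close> afterwards. The hypothesis on the weights is the weaker of these bounds,
  cleared of denominators so as to admit \<open>p = 1\<close>; it is preserved by a step in either direction, and
  a step to \<open>0\<close> makes it void as the two positions merge. For \<open>i > 0\<close> it implies \<open>\<beta> \<le> \<alpha>\<close>, so that at
  least half of the mass moves outwards.
\<close>

lemma survival_mixture_le:
  assumes "1 / 2 \<le> p" "p \<le> 1" "0 \<le> \<alpha>" "0 \<le> \<beta>"
    and "i > 0 \<Longrightarrow> \<beta> * p ^ (i - 1) \<le> \<alpha> * (1 - p) ^ (i - 1)"
  shows "\<alpha> * survival b p m j (int i) + \<beta> * survival b p m j (- int i)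
           \<le> (\<alpha> + \<beta>) * survival b (1 / 2) m j (int i)"
  using assms(3-)
proof (induction m arbitrary: j i \<alpha> \<beta>)
  case (Suc m)
  define V where "V y = of_bool (\<bar>y\<bar> < b (Suc j)) * survival b (1 / 2) m (Suc j) y" for y
  define W where "W y = of_bool (\<bar>y\<bar> < b (Suc j)) * survival b p m (Suc j) y" for y
  have step: "\<gamma> * W (int k) + \<delta> * W (- int k) \<le> (\<gamma> + \<delta>) * V (int k)"
    if "0 \<le> \<gamma>" "0 \<le> \<delta>" "k > 0 \<Longrightarrow> \<delta> * p ^ (k - 1) \<le> \<gamma> * (1 - p) ^ (k - 1)" for \<gamma> \<delta> k
    using Suc.IH[OF that] by (auto simp: W_def V_def)
  show ?case
  proof (cases i)
    case 0
    have "p * W 1 + (1 - p) * W (- 1) \<le> V 1"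
      using step[of p "1 - p" 1] assms(1,2) by simp
    moreover have "V (- 1) = V 1"
      using survival_fair_abs[of b m "Suc j" "- 1"] by (simp add: V_def)
    moreover have "survival b p (Suc m) j 0 = p * W 1 + (1 - p) * W (- 1)"
      "survival b (1 / 2) (Suc m) j 0 = 1 / 2 * V 1 + (1 - 1 / 2) * V (- 1)"
      by (simp_all add: V_def W_def)
    ultimately have "survival b p (Suc m) j 0 \<le> survival b (1 / 2) (Suc m) j 0"
      by (simp del: survival.simps)
    then have "(\<alpha> + \<beta>) * survival b p (Suc m) j 0 \<le> (\<alpha> + \<beta>) * survival b (1 / 2) (Suc m) j 0"
      using Suc.prems by (intro mult_left_mono) auto
    then show ?thesis
      by (simp only: 0 of_nat_0 minus_zero distrib_right)
  next
    case (Suc k)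
    have ratio: "\<beta> * p ^ k \<le> \<alpha> * (1 - p) ^ k"
      using Suc.prems(3) Suc by simp
    have "\<beta> \<le> \<alpha>"
    proof -
      have "\<alpha> * (1 - p) ^ k \<le> \<alpha> * p ^ k"
        using assms(1,2) Suc.prems by (intro mult_left_mono power_mono) auto
      with ratio have "\<beta> * p ^ k \<le> \<alpha> * p ^ k" by simp
      with assms(1) show ?thesis by simp
    qed
    have outer: "(\<alpha> * p) * W (int i + 1) + (\<beta> * (1 - p)) * W (- (int i + 1))
        \<le> (\<alpha> * p + \<beta> * (1 - p)) * V (int i + 1)"
    proof -
      have "(\<beta> * p ^ k) * (p * (1 - p)) \<le> (\<alpha> * (1 - p) ^ k) * (p * (1 - p))"
        using ratio assms(1,2) by (intro mult_right_mono) auto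
      then have "(\<beta> * (1 - p)) * p ^ i \<le> (\<alpha> * p) * (1 - p) ^ i"
        by (simp add: Suc algebra_simps)
      with step[of "\<alpha> * p" "\<beta> * (1 - p)" "Suc i"] assms(1,2) Suc.prems show ?thesis
        by (simp add: add.commute)
    qed
    have inner: "(\<alpha> * (1 - p)) * W (int i - 1) + (\<beta> * p) * W (- (int i - 1))
        \<le> (\<alpha> * (1 - p) + \<beta> * p) * V (int i - 1)"
    proof -
      have "(\<beta> * p) * p ^ (k - 1) \<le> (\<alpha> * (1 - p)) * (1 - p) ^ (k - 1)" if "k > 0"
        using ratio that by (cases k) (auto simp: mult_ac)
      with step[of "\<alpha> * (1 - p)" "\<beta> * p" k] assms(1,2) Suc.prems show ?thesis
        by (simp add: Suc)
    qed
    have V_le: "V (int i + 1) \<le> V (int i - 1)"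
      unfolding V_def using survival_fair_antimono[of "int i - 1" "int i + 1" b m "Suc j"]
      by (auto simp: Suc survival_nonneg)
    \<comment> \<open>The outward mass exceeds half of \<open>\<alpha> + \<beta>\<close> by half of \<open>(\<alpha> - \<beta>) * (2 * p - 1)\<close>.\<close>
    have "0 \<le> (\<alpha> - \<beta>) * (2 * p - 1) * (V (int i - 1) - V (int i + 1))"
      using \<open>\<beta> \<le> \<alpha>\<close> assms(1) V_le by simp
    then have mass: "(\<alpha> * p + \<beta> * (1 - p)) * V (int i + 1) + (\<alpha> * (1 - p) + \<beta> * p) * V (int i - 1)
        \<le> (\<alpha> + \<beta>) * (1 / 2 * V (int i + 1) + (1 - 1 / 2) * V (int i - 1))"
      by (simp add: field_simps)
    have "survival b p (Suc m) j (int i) = p * W (int i + 1) + (1 - p) * W (int i - 1)"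
      by (simp add: W_def)
    moreover have "survival b p (Suc m) j (- int i) =
        p * W (- (int i - 1)) + (1 - p) * W (- (int i + 1))"
    proof -
      have "- (int i - 1) = - int i + 1" "- (int i + 1) = - int i - 1" by simp_all
      then show ?thesis by (simp only: W_def survival.simps)
    qed
    moreover have "survival b (1 / 2) (Suc m) j (int i) =
        1 / 2 * V (int i + 1) + (1 - 1 / 2) * V (int i - 1)"
      by (simp add: V_def)
    ultimately show ?thesis
      using outer inner mass by (simp only: distrib_left)
  qed
qed simp

lemma survival_start_le:
  assumes "0 \<le> p" "p \<le> 1"
  shows "survival b p n 0 1 + survival b p n 0 (- 1) \<le> 2 * survival b (1 / 2) n 0 1"
proof (cases "1 / 2 \<le> p")
  case True
  then show ?thesis using survival_mixture_le[of p 1 1 1 b n 0] assms by simp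
next
  case False
  then show ?thesis
    using survival_mixture_le[of "1 - p" 1 1 1 b n 0] assms
      survival_reflect[of b p n 0 1] survival_reflect[of b p n 0 "- 1"] by simp
qed

section \<open>The law of the exit time\<close>

lemma exit_time_greater_iff:
  "enat n < exit_time b U \<omega> \<longleftrightarrow> (\<forall>k\<in>{0<..n}. \<bar>U k \<omega>\<bar> < b k)"
proof
  assume *: "enat n < exit_time b U \<omega>"
  show "\<forall>k\<in>{0<..n}. \<bar>U k \<omega>\<bar> < b k"
  proof (rule ballI, rule ccontr)
    fix k assume k: "k \<in> {0<..n}" "\<not> \<bar>U k \<omega>\<bar> < b k"
    then have "exit_time b U \<omega> \<le> enat k"
      unfolding exit_time_def by (intro Inf_lower) auto
    with * k show False by (meson enat_ord_simps(1) greaterThanAtMost_iff leD order_trans)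
  qed
next
  assume *: "\<forall>k\<in>{0<..n}. \<bar>U k \<omega>\<bar> < b k"
  have "enat (Suc n) \<le> exit_time b U \<omega>"
    unfolding exit_time_def
  proof (rule Inf_greatest)
    fix t assume "t \<in> {enat n |n. n \<ge> 1 \<and> \<bar>U n \<omega>\<bar> \<ge> b n}"
    then obtain k where "t = enat k" "k \<ge> 1" "\<bar>U k \<omega>\<bar> \<ge> b k" by auto
    with * show "enat (Suc n) \<le> t"
      using leD[of "b k" "\<bar>U k \<omega>\<bar>"] by (cases "k \<le> n") simp_all
  qed
  then show "enat n < exit_time b U \<omega>"
    by (meson enat_ord_simps(2) lessI less_le_trans)
qed

context random_sign_walk
begin

definition letter :: "nat \<Rightarrow> 'a \<Rightarrow> int" where
  "letter n = (if n = 0 then X0 else X n)"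

lemma measurable_letter [measurable]: "letter n \<in> measurable M (count_space UNIV)"
  using indep unfolding indep_vars_def letter_def by auto

lemma walk_eq_sum_letter: "walk X0 X n \<omega> = (\<Sum>i\<le>n. letter i \<omega>)"
  by (induction n) (auto simp: walk_def letter_def)

lemma measurable_walk [measurable]: "walk X0 X n \<in> measurable M (count_space UNIV)"
proof (induction n)
  case 0
  then show ?case
    using measurable_letter[of 0] by (simp add: walk_eq_sum_letter[abs_def])
next
  case (Suc n)
  have "(\<lambda>\<omega>. walk X0 X n \<omega> + letter (Suc n) \<omega>) \<in> measurable M (count_space UNIV)"
    by (rule measurable_compose_countable[OF measurable_compose[OF measurable_letter] Suc]) simp
  then show ?case
    by (simp add: walk_eq_sum_letter[abs_def])
qed

definition cylinder :: "(nat \<Rightarrow> int) \<Rightarrow> nat \<Rightarrow> 'a set" where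
  "cylinder x j = {\<omega> \<in> space M. \<forall>i\<le>j. letter i \<omega> = x i}"

definition stay :: "(nat \<Rightarrow> int) \<Rightarrow> nat \<Rightarrow> nat \<Rightarrow> 'a set" where
  "stay b j k = {\<omega> \<in> space M. \<forall>i\<in>{j<..k}. \<bar>walk X0 X i \<omega>\<bar> < b i}"

lemma sets_cylinder [measurable]: "cylinder x j \<in> sets M"
  unfolding cylinder_def by measurable

lemma sets_stay [measurable]: "stay b j k \<in> sets M"
proof -
  have [measurable]: "Measurable.pred M (\<lambda>\<omega>. \<bar>walk X0 X i \<omega>\<bar> < b i)" for i
    by (rule measurable_compose[OF measurable_walk]) simp
  show ?thesis
    unfolding stay_def by measurable
qed

lemma prob_cylinder:
  "prob (cylinder x j) = (\<Prod>i\<le>j. prob {\<omega> \<in> space M. letter i \<omega> = x i})"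
proof -
  have "prob (\<Inter>i\<in>{..j}. letter i -` {x i} \<inter> space M) =
      (\<Prod>i\<le>j. prob (letter i -` {x i} \<inter> space M))"
    using indep_varsD[OF indep, of "{..j}" "\<lambda>i. {x i}"] by (simp add: letter_def[abs_def] if_distrib)
  moreover have "cylinder x j = (\<Inter>i\<in>{..j}. letter i -` {x i} \<inter> space M)"
    by (auto simp: cylinder_def)
  moreover have "letter i -` {x i} \<inter> space M = {\<omega> \<in> space M. letter i \<omega> = x i}" for i
    by auto
  ultimately show ?thesis by simp
qed

lemma prob_cylinder_up: "prob (cylinder (x(Suc j := 1)) (Suc j)) = p * prob (cylinder x j)"
  and prob_cylinder_down:
    "prob (cylinder (x(Suc j := - 1)) (Suc j)) = (1 - p) * prob (cylinder x j)"
  unfolding prob_cylinder using step_pos[of "Suc j"] step_neg[of "Suc j"]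
  by (simp_all add: letter_def)

lemma walk_on_cylinder: "\<omega> \<in> cylinder x j \<Longrightarrow> walk X0 X j \<omega> = (\<Sum>i\<le>j. x i)"
  by (simp add: walk_eq_sum_letter cylinder_def)

lemma AE_letter_sign: "AE \<omega> in M. letter j \<omega> = 1 \<or> letter j \<omega> = - 1"
proof -
  have "prob {\<omega> \<in> space M. letter j \<omega> = 1} + prob {\<omega> \<in> space M. letter j \<omega> = - 1} = 1"
    using start_pos start_neg step_pos[of j] step_neg[of j] by (simp add: letter_def)
  then have "prob ({\<omega> \<in> space M. letter j \<omega> = 1} \<union> {\<omega> \<in> space M. letter j \<omega> = - 1}) = 1"
    by (subst finite_measure_Union) auto
  moreover have "{\<omega> \<in> space M. letter j \<omega> = 1} \<union> {\<omega> \<in> space M. letter j \<omega> = - 1} =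
      {\<omega> \<in> space M. letter j \<omega> = 1 \<or> letter j \<omega> = - 1}" by auto
  ultimately show ?thesis
    by (subst prob_Collect_eq_1[symmetric]) auto
qed

lemma prob_split_letter:
  assumes [measurable]: "A \<in> sets M"
  shows "prob A = prob (A \<inter> {\<omega> \<in> space M. letter j \<omega> = 1})
                + prob (A \<inter> {\<omega> \<in> space M. letter j \<omega> = - 1})"
proof -
  have "prob A = prob ((A \<inter> {\<omega> \<in> space M. letter j \<omega> = 1}) \<union>
      (A \<inter> {\<omega> \<in> space M. letter j \<omega> = - 1}))"
    using AE_letter_sign[of j] sets.sets_into_space[OF assms]
    by (intro finite_measure_eq_AE) auto
  also have "\<dots> = prob (A \<inter> {\<omega> \<in> space M. letter j \<omega> = 1})
                + prob (A \<inter> {\<omega> \<in> space M. letter j \<omega> = - 1})"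
    by (intro finite_measure_Union) auto
  finally show ?thesis .
qed

text \<open>
  This is the Markov property in the form needed here. Conditioning on the whole past up to time \<open>j\<close>
  instead of on the position alone reduces it to the product formula for cylinders.
\<close>

lemma prob_cylinder_stay:
  "prob (cylinder x j \<inter> stay b j (j + m)) = prob (cylinder x j) * survival b p m j (\<Sum>i\<le>j. x i)"
proof (induction m arbitrary: x j)
  case 0
  have "cylinder x j \<inter> stay b j (j + 0) = cylinder x j"
    by (auto simp: cylinder_def stay_def)
  then show ?case by simp
next
  case (Suc m)
  have branch: "prob (cylinder x j \<inter> stay b j (j + Suc m) \<inter> {\<omega> \<in> space M. letter (Suc j) \<omega> = e}) =
      of_bool (\<bar>(\<Sum>i\<le>j. x i) + e\<bar> < b (Suc j)) *
      (prob (cylinder (x(Suc j := e)) (Suc j)) * survival b p m (Suc j) ((\<Sum>i\<le>j. x i) + e))" for e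
  proof -
    let ?y = "x(Suc j := e)"
    have cyl: "cylinder x j \<inter> {\<omega> \<in> space M. letter (Suc j) \<omega> = e} = cylinder ?y (Suc j)"
      by (auto simp: cylinder_def le_Suc_eq)
    have pos: "(\<Sum>i\<le>Suc j. ?y i) = (\<Sum>i\<le>j. x i) + e" by simp
    have "{j<..j + Suc m} = insert (Suc j) {Suc j<..Suc j + m}" by auto
    then have st: "stay b j (j + Suc m) =
        {\<omega> \<in> space M. \<bar>walk X0 X (Suc j) \<omega>\<bar> < b (Suc j)} \<inter> stay b (Suc j) (Suc j + m)"
      by (auto simp: stay_def)
    have "cylinder x j \<inter> stay b j (j + Suc m) \<inter> {\<omega> \<in> space M. letter (Suc j) \<omega> = e} =
        (if \<bar>(\<Sum>i\<le>j. x i) + e\<bar> < b (Suc j)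
         then cylinder ?y (Suc j) \<inter> stay b (Suc j) (Suc j + m) else {})"
      using walk_on_cylinder[of _ ?y "Suc j"] unfolding pos cyl[symmetric] st by auto
    then show ?thesis
      using Suc[of ?y "Suc j"] unfolding pos by (simp del: fun_upd_apply)
  qed
  have "prob (cylinder x j \<inter> stay b j (j + Suc m)) =
      prob (cylinder x j \<inter> stay b j (j + Suc m) \<inter> {\<omega> \<in> space M. letter (Suc j) \<omega> = 1}) +
      prob (cylinder x j \<inter> stay b j (j + Suc m) \<inter> {\<omega> \<in> space M. letter (Suc j) \<omega> = - 1})"
    by (intro prob_split_letter) measurable
  then show ?case
    unfolding branch prob_cylinder_up prob_cylinder_down by (simp add: algebra_simps)
qed

lemma prob_exit_time_greater:
  "prob {\<omega> \<in> space M. exit_time b (walk X0 X) \<omega> > enat n} =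
     (survival b p n 0 1 + survival b p n 0 (- 1)) / 2"
proof -
  have start: "stay b 0 n \<inter> {\<omega> \<in> space M. letter 0 \<omega> = e} =
      cylinder (\<lambda>_. e) 0 \<inter> stay b 0 (0 + n)" for e
    by (auto simp: cylinder_def)
  have half: "prob (cylinder (\<lambda>_. 1) 0) = 1 / 2" "prob (cylinder (\<lambda>_. - 1) 0) = 1 / 2"
    using start_pos start_neg by (simp_all add: prob_cylinder letter_def)
  have "prob (stay b 0 n) = (survival b p n 0 1 + survival b p n 0 (- 1)) / 2"
    using prob_split_letter[OF sets_stay, of b 0 n 0]
    unfolding start prob_cylinder_stay half by simp
  moreover have "{\<omega> \<in> space M. exit_time b (walk X0 X) \<omega> > enat n} = stay b 0 n"
    by (simp add: stay_def exit_time_greater_iff)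
  ultimately show ?thesis by simp
qed

end

section \<open>The fair walk maximizes the exit time\<close>

theorem corollary2:
  fixes M :: "real \<Rightarrow> 'a measure"
    and X0 :: "real \<Rightarrow> 'a \<Rightarrow> int"
    and X :: "real \<Rightarrow> nat \<Rightarrow> 'a \<Rightarrow> int"
    and b :: "nat \<Rightarrow> int"
  assumes "\<And>p. p \<in> {0..1} \<Longrightarrow> random_sign_walk (M p) p (X0 p) (X p)"
    and "\<And>n. n \<ge> 1 \<Longrightarrow> b n \<ge> 0"
  shows "stochastically_maximized M (\<lambda>p. exit_time b (walk (X0 p) (X p))) {0..1} (1 / 2)"
proof -
  have prob_eq: "measure (M p) {\<omega> \<in> space (M p). exit_time b (walk (X0 p) (X p)) \<omega> > enat n} =
      (survival b p n 0 1 + survival b p n 0 (- 1)) / 2" if "p \<in> {0..1}" for p n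
    using random_sign_walk.prob_exit_time_greater[OF assms(1)[OF that]] .
  have "survival b (1 / 2) n 0 (- 1) = survival b (1 / 2) n 0 1" for n
    using survival_fair_abs[of b n 0 "- 1"] by simp
  then have "(survival b p n 0 1 + survival b p n 0 (- 1)) / 2
      \<le> (survival b (1 / 2) n 0 1 + survival b (1 / 2) n 0 (- 1)) / 2" if "p \<in> {0..1}" for p n
    using survival_start_le[of p b n] that by simp
  then show ?thesis
    unfolding stochastically_maximized_def by (simp add: prob_eq)
qed

end
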